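(* Every connected graph $G$ with minimum degree at least $3$ contains a spanning tree $T$ without three consecutive vertices of degree $2$; that is, there is no path $xyz$ in $T$ such that $x$, $y$ and $z$ all have degree $2$ in $T$.
   Context: All graphs are simple and finite. *)

theory Defs
  imports "Graph_Theory.Graph_Theory"
begin

text \<open>
  A finite simple graph is a \<^locale>\<open>pair_graph\<close>: each undirected edge \<open>{u, v}\<close> is the
  pair of arcs \<open>(u, v)\<close> and \<open>(v, u)\<close>. Consequently the degree of a vertex is its number of
  outgoing arcs.
\<close>

abbreviation degree :: "'a pair_pre_digraph \<Rightarrow> 'a \<Rightarrow> nat" where
  "degree G v \<equiv> out_degree (with_proj G) v"

text \<open>
  The predicates \<^const>\<open>forest\<close>, \<^const>\<open>tree\<close> and \<^const>\<open>spanning_tree\<close> of the library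
  refer to directed cycles, and count traversing an edge back and forth as a cycle of length 2;
  no symmetric digraph with an edge satisfies them. The cycles of an undirected simple graph are
  exactly the cycles of length at least 3 of its symmetric digraph.
\<close>

definition undirected_forest :: "'a pair_pre_digraph \<Rightarrow> bool" where
  "undirected_forest T \<longleftrightarrow>
     pair_graph T \<and> \<not> (\<exists>p. pre_digraph.cycle (with_proj T) p \<and> length p \<ge> 3)"

definition undirected_tree :: "'a pair_pre_digraph \<Rightarrow> bool" where
  "undirected_tree T \<longleftrightarrow> connected (with_proj T) \<and> undirected_forest T"

definition undirected_spanning_tree ::
    "'a pair_pre_digraph \<Rightarrow> 'a pair_pre_digraph \<Rightarrow> bool" where
  "undirected_spanning_tree T G \<longleftrightarrow>
     undirected_tree T \<and> spanning (with_proj T) (with_proj G)"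

end

theory Submission
  imports Defs
begin

text \<open>
  Grow a subtree of \<open>G\<close> by attaching new leaves, never creating three consecutive vertices of
  degree 2 and keeping every leaf that still has neighbours outside the tree adjacent to a vertex
  of degree at least 3. If no vertex can be brought to degree at least 3 by attaching all its
  outside neighbours, every vertex with an outside neighbour \<open>u\<close> is a leaf \<open>v\<close> with no
  other outside neighbour. Then attach \<open>u\<close> to \<open>v\<close> and continue from \<open>u\<close>: either a vertex of
  degree at least 3 appears within two further steps, or the new leaves have no neighbour
  left outside. Hence a maximal such tree spans \<open>G\<close>.
\<close>

section \<open>Attaching leaves\<close>

text \<open>Both orientations are added, so that symmetry is kept. All leaves of \<open>A\<close> go
  in at once because an intermediate tree could violate the degree condition: at the end of a path
  whose two preceding vertices have degree 2, a single new leaf creates three consecutive ones,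
  while two leaves together do not.\<close>

definition attach :: "'a pair_pre_digraph \<Rightarrow> 'a \<Rightarrow> 'a set \<Rightarrow> 'a pair_pre_digraph" where
  "attach T x A = \<lparr>pverts = pverts T \<union> A, parcs = parcs T \<union> {x} \<times> A \<union> A \<times> {x}\<rparr>"

lemma pverts_attach [simp]: "pverts (attach T x A) = pverts T \<union> A"
  and parcs_attach [simp]: "parcs (attach T x A) = parcs T \<union> {x} \<times> A \<union> A \<times> {x}"
  by (simp_all add: attach_def)

lemma attach_empty [simp]: "attach T x {} = T"
  by (simp add: attach_def)

lemma attach_insert: "attach T x (insert a A) = attach (attach T x A) x {a}"
  by (auto simp: attach_def)

lemma degree_eq_card_Image: "degree T v = card (parcs T `` {v})"
proof -
  have "out_arcs (with_proj T) v = Pair v ` (parcs T `` {v})"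
    by (auto simp: out_arcs_def)
  then show ?thesis
    by (simp add: out_degree_def card_image inj_on_def)
qed

lemma pair_graph_attach:
  assumes "pair_graph T" "x \<in> pverts T" "A \<inter> pverts T = {}" "finite A"
  shows "pair_graph (attach T x A)"
proof -
  interpret pair_graph T by fact
  have "symmetric (with_proj (attach T x A))"
    using arcs_symmetric by (auto simp: symmetric_def intro!: symI)
  then show ?thesis
    using assms wellformed' no_loops' pair_finite_verts pair_finite_arcs
    by unfold_locales auto
qed

lemma degree_attach:
  assumes "pair_graph T" "x \<in> pverts T" "A \<inter> pverts T = {}" "finite A"
  shows degree_attach_root: "degree (attach T x A) x = degree T x + card A"
    and degree_attach_leaf: "v \<in> A \<Longrightarrow> degree (attach T x A) v = 1"
    and degree_attach_other: "v \<noteq> x \<Longrightarrow> v \<notin> A \<Longrightarrow> degree (attach T x A) v = degree T v"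
proof -
  interpret pair_graph T by fact
  have "parcs (attach T x A) `` {x} = parcs T `` {x} \<union> A"
    using assms by auto
  moreover have "parcs T `` {x} \<inter> A = {}"
    using assms(3) wellformed' by blast
  moreover have "finite (parcs T `` {x})"
    using pair_finite_arcs by (simp add: finite_Image)
  ultimately show "degree (attach T x A) x = degree T x + card A"
    using assms(4) by (simp add: degree_eq_card_Image card_Un_disjoint del: parcs_attach)
  show "degree (attach T x A) v = 1" if "v \<in> A"
  proof -
    have "parcs (attach T x A) `` {v} = {x}"
      using that assms(2,3) wellformed' by auto
    then show ?thesis by (simp add: degree_eq_card_Image del: parcs_attach)
  qed
  show "degree (attach T x A) v = degree T v" if "v \<noteq> x" "v \<notin> A"
  proof -
    have "parcs (attach T x A) `` {v} = parcs T `` {v}" using that by auto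
    then show ?thesis by (simp add: degree_eq_card_Image del: parcs_attach)
  qed
qed

text \<open>Old vertices are reached from \<open>x\<close> inside \<open>T\<close>, new ones by a
  single arc; by symmetry any two vertices are joined through \<open>x\<close>.\<close>

lemma connected_attach:
  assumes "pair_graph T" "x \<in> pverts T" "A \<inter> pverts T = {}" "finite A"
    and "connected (with_proj T)"
  shows "connected (with_proj (attach T x A))"
proof -
  interpret T: pair_graph T by fact
  interpret T': pair_graph "attach T x A" by (rule pair_graph_attach) fact+
  have x_reach: "x \<rightarrow>\<^sup>*\<^bsub>with_proj (attach T x A)\<^esub> v" if "v \<in> pverts T \<union> A" for v
  proof (cases "v \<in> A")
    case True
    then show ?thesis by (intro T'.reachable_adjI) auto
  next
    case False
    have "x \<rightarrow>\<^sup>*\<^bsub>with_proj T\<^esub> v"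
      using T.symmetric_connected_imp_strongly_connected[OF T.sym_arcs assms(5)] False that assms(2)
      by (auto simp: strongly_connected_def)
    then show ?thesis
      unfolding reachable_def by (rule rtrancl_on_mono[rotated 2]) auto
  qed
  have reach_x: "v \<rightarrow>\<^sup>*\<^bsub>with_proj (attach T x A)\<^esub> x" if "v \<in> pverts T \<union> A" for v
    using T'.symmetric_reachable' x_reach[OF that] by blast
  show ?thesis
    unfolding connected_def strongly_connected_def
    using assms(2) x_reach reach_x T'.reachable_trans T'.reachable_mk_symmetricI
    by simp blast
qed

section \<open>Cycles\<close>

lemma pawalk_verts_pcas: "pcas u p v \<Longrightarrow> pawalk_verts u p = u # map snd p"
  by (induction u p v rule: pcas.induct) auto

lemma pcas_append_iff: "pcas u (p @ q) v \<longleftrightarrow> (\<exists>w. pcas u p w \<and> pcas w q v)"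
  by (induction p arbitrary: u) auto

lemma insert_fst_pcas: "pcas u p v \<Longrightarrow> insert v (fst ` set p) = insert u (snd ` set p)"
  by (induction u p v rule: pcas.induct) auto

lemma pcas_ends_in:
  assumes "pcas u p v" "p \<noteq> []"
  shows "u \<in> fst ` set p" "v \<in> snd ` set p"
proof -
  show "u \<in> fst ` set p" using assms by (cases p) auto
  show "v \<in> snd ` set p" using assms by (cases p rule: rev_cases) (auto simp: pcas_append_iff)
qed

text \<open>The vertices of a walk after its first one are the heads of its arcs, and the base point
  lies in the graph because the first arc does. In this form invariance under rotation is
  immediate.\<close>

lemma cycle_with_proj_iff:
  assumes "pair_wf_digraph T"
  shows "pre_digraph.cycle (with_proj T) p \<longleftrightarrow>
    p \<noteq> [] \<and> set p \<subseteq> parcs T \<and> (\<exists>u. pcas u p u) \<and> distinct (map snd p)"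
proof -
  interpret pair_wf_digraph T by fact
  have "u \<in> pverts T" if "pcas u p u" "p \<noteq> []" "set p \<subseteq> parcs T" for u
    using that wellformed' by (cases p) auto
  then show ?thesis
    unfolding cycle_def awalk_def by (metis list.sel(3) pawalk_verts_pcas)
qed

lemma cycle_rotate:
  assumes "pair_wf_digraph T" "pre_digraph.cycle (with_proj T) (p @ q)"
  shows "pre_digraph.cycle (with_proj T) (q @ p)"
  using assms by (auto simp: cycle_with_proj_iff pcas_append_iff)

text \<open>A cycle using a new arc passes through \<open>a\<close> and can be rotated to start
  there. As \<open>x\<close> is the only neighbour of \<open>a\<close>, the first arc enters
  \<open>x\<close> and the last arc leaves \<open>x\<close>, so the penultimate arc enters
  \<open>x\<close> too. Length at least 3 makes the first and the penultimate arc different, against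
  distinctness of heads.\<close>

lemma undirected_forest_attach_single:
  assumes "undirected_forest T" "x \<in> pverts T" "a \<notin> pverts T"
  shows "undirected_forest (attach T x {a})"
proof -
  let ?T' = "attach T x {a}"
  have T: "pair_graph T" using assms(1) by (simp add: undirected_forest_def)
  interpret T: pair_graph T by fact
  have T': "pair_graph ?T'" by (rule pair_graph_attach) (use T assms in auto)
  interpret T': pair_graph ?T' by fact
  have wf: "pair_wf_digraph T" "pair_wf_digraph ?T'" by unfold_locales
  have False if cyc: "pre_digraph.cycle (with_proj ?T') p" and len: "length p \<ge> 3" for p
  proof (cases "set p \<subseteq> parcs T")
    case True
    then have "pre_digraph.cycle (with_proj T) p"
      using cyc by (simp add: cycle_with_proj_iff wf)
    then show False using assms(1) len by (auto simp: undirected_forest_def)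
  next
    case False
    then have "a \<in> fst ` set p \<union> snd ` set p"
      using cyc by (force simp: cycle_with_proj_iff wf)
    moreover obtain u where "pcas u p u" "p \<noteq> []"
      using cyc by (auto simp: cycle_with_proj_iff wf)
    \<comment> \<open>On a closed walk every head is also a tail, so some arc of \<open>p\<close>
      leaves \<open>a\<close> even if \<open>a\<close> was only found as a head.\<close>
    then have "fst ` set p = snd ` set p"
      using insert_fst_pcas[of u p u] pcas_ends_in[of u p u] by (metis insert_absorb)
    ultimately obtain y where "(a, y) \<in> set p" by force
    then obtain p1 p2 where "p = p1 @ (a, y) # p2" by (auto simp: in_set_conv_decomp)
    then have c: "pre_digraph.cycle (with_proj ?T') ((a, y) # p2 @ p1)"
      using cycle_rotate[OF wf(2), of p1 "(a, y) # p2"] cyc by simp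
    have "p2 @ p1 \<noteq> []" using len \<open>p = _\<close> by auto
    then obtain q z w where q: "p2 @ p1 = q @ [(z, w)]" by (metis rev_exhaust surj_pair)
    have "q \<noteq> []" using len \<open>p = _\<close> arg_cong[OF q, of length] by auto
    then obtain q' z' w' where q': "q = q' @ [(z', w')]" by (metis rev_exhaust surj_pair)
    have "w = a" "w' = z" "(a, y) \<in> parcs ?T'" "(z, w) \<in> parcs ?T'" "y \<noteq> w'"
      using c unfolding q q' by (auto simp: cycle_with_proj_iff wf pcas_append_iff)
    then show False using assms(2,3) T.wellformed' by auto
  qed
  then show ?thesis using T' by (auto simp: undirected_forest_def)
qed

lemma undirected_tree_attach:
  assumes "undirected_tree T" "x \<in> pverts T" "A \<inter> pverts T = {}" "finite A"
  shows "undirected_tree (attach T x A)"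
proof -
  have "undirected_forest (attach T x A)"
    using assms(4,3)
  proof (induction A rule: finite_induct)
    case empty
    then show ?case using assms(1) by (simp add: undirected_tree_def)
  next
    case (insert a A)
    then show ?case
      using assms(2) by (simp add: attach_insert[of T x a A] undirected_forest_attach_single)
  qed
  moreover have "connected (with_proj (attach T x A))"
    using assms by (intro connected_attach) (auto simp: undirected_tree_def undirected_forest_def)
  ultimately show ?thesis by (simp add: undirected_tree_def)
qed

section \<open>Growing a tree\<close>

text \<open>Vertices without outside neighbours are unconstrained. For the others the condition
  makes the next attachment safe: from degree at least 2, one new leaf already gives degree at least
  3; a leaf that rises only to degree 2 has a neighbour of degree at least 3 shielding it.\<close>

definition settled :: "'a pair_pre_digraph \<Rightarrow> 'a pair_pre_digraph \<Rightarrow> 'a \<Rightarrow> bool" where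
  "settled G T v \<longleftrightarrow> parcs G `` {v} \<subseteq> pverts T \<or>
     degree T v \<noteq> 0 \<and> (degree T v = 1 \<longrightarrow> (\<forall>p. (v, p) \<in> parcs T \<longrightarrow> 3 \<le> degree T p))"

text \<open>\<open>X\<close> holds vertices temporarily exempt from being settled, so that several
  attachments can be chained before the invariant is restored with \<open>X = {}\<close>.\<close>

definition partial_tree ::
    "'a pair_pre_digraph \<Rightarrow> 'a pair_pre_digraph \<Rightarrow> 'a set \<Rightarrow> bool" where
  "partial_tree G T X \<longleftrightarrow>
     undirected_tree T \<and> pverts T \<subseteq> pverts G \<and> parcs T \<subseteq> parcs G \<and>
     (\<forall>x y z. (x, y) \<in> parcs T \<longrightarrow> (y, z) \<in> parcs T \<longrightarrow> x \<noteq> z \<longrightarrow>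
        degree T x = 2 \<longrightarrow> degree T y = 2 \<longrightarrow> degree T z \<noteq> 2) \<and>
     (\<forall>v \<in> pverts T - X. settled G T v)"

text \<open>Only the degree of \<open>x\<close> changes among old vertices, and new vertices have
  degree 1. So a new bad path contains \<open>x\<close>, now of degree exactly 2 and earlier of
  degree at most 1; hence \<open>x\<close> is an end of it, which \<open>no_path\<close> forbids.
  Degrees of old vertices never drop, so settled vertices stay settled, and \<open>x\<close> itself
  becomes settled. The new leaves are settled if \<open>x\<close> reaches degree 3 and are exempted
  otherwise.\<close>

lemma partial_tree_attach:
  assumes G: "pair_graph G" and T: "partial_tree G T X"
    and x: "x \<in> pverts T" and A: "A \<subseteq> parcs G `` {x} - pverts T" "A \<noteq> {}"
    and deg: "2 \<le> degree T x + card A"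
    and no_path: "\<And>p q. degree T x + card A = 2 \<Longrightarrow> (x, p) \<in> parcs T \<Longrightarrow> (p, q) \<in> parcs T \<Longrightarrow>
      q \<noteq> x \<Longrightarrow> degree T p = 2 \<Longrightarrow> degree T q \<noteq> 2"
  shows "partial_tree G (attach T x A)
    (X - {x} \<union> (if 3 \<le> degree T x + card A then {} else A))"
proof -
  interpret G: pair_graph G by fact
  have pT: "pair_graph T"
    using T by (auto simp: partial_tree_def undirected_tree_def undirected_forest_def)
  interpret T: pair_graph T by fact
  have sub: "pverts T \<subseteq> pverts G" "parcs T \<subseteq> parcs G" and tree: "undirected_tree T"
    using T by (auto simp: partial_tree_def)
  have A_G: "A \<subseteq> pverts G" using A(1) G.wellformed' by auto
  then have fin: "finite A" using G.pair_finite_verts finite_subset by blast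
  have disj: "A \<inter> pverts T = {}" using A(1) by auto
  let ?T' = "attach T x A"
  note deg_simps = degree_attach[OF pT x disj fin]
  have arcs_old: "(y, z) \<in> parcs T" if "(y, z) \<in> parcs ?T'" "y \<notin> A" "z \<notin> A" for y z
    using that x disj by auto
  have arcs_leaf: "y = x" if "(y, z) \<in> parcs ?T'" "z \<in> A" for y z
    using that x disj T.wellformed' by auto
  have arcs_leaf': "z = x" if "(y, z) \<in> parcs ?T'" "y \<in> A" for y z
    using that x disj T.wellformed' by auto
  have deg_mono: "degree T v \<le> degree ?T' v" if "v \<in> pverts T" for v
  proof -
    have "v \<notin> A" using that disj by auto
    then show ?thesis using deg_simps(1) deg_simps(3)[of v] by (cases "v = x") simp_all
  qed
  have no_bad: "degree ?T' z \<noteq> 2"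
    if h: "(y1, y2) \<in> parcs ?T'" "(y2, z) \<in> parcs ?T'" "y1 \<noteq> z"
      "degree ?T' y1 = 2" "degree ?T' y2 = 2" for y1 y2 z
  proof
    assume z2: "degree ?T' z = 2"
    have "v \<notin> A" if "degree ?T' v = 2" for v using that deg_simps(2)[of v] by auto
    then have nA: "y1 \<notin> A" "y2 \<notin> A" "z \<notin> A" using h(4,5) z2 by blast+
    have old: "(y1, y2) \<in> parcs T" "(y2, z) \<in> parcs T"
      using arcs_old h(1,2) nA by auto
    have cardA: "card A \<ge> 1" using A(2) fin by (simp add: Suc_le_eq card_gt_0_iff)
    have deg_old: "degree T v = 2" if "degree ?T' v = 2" "v \<noteq> x" "v \<notin> A" for v
      using that deg_simps(3) by metis
    consider "y1 = x" | "y2 = x" | "z = x" | "x \<notin> {y1, y2, z}" by blast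
    then show False
    proof cases
      case 1
      then have "y2 \<noteq> x" "z \<noteq> x" using old(1) h(3) T.no_loops' by auto
      then show False using no_path[of y2 z] 1 old h z2 deg_simps(1) deg_old nA by auto
    next
      case 2
      \<comment> \<open>As the middle vertex, \<open>x\<close> would have had two neighbours before
        the attachment, so its degree would now exceed 2.\<close>
      have "{y1, z} \<subseteq> parcs T `` {x}" using 2 old T.arcs_symmetric by auto
      moreover have "finite (parcs T `` {x})" using T.pair_finite_arcs by (simp add: finite_Image)
      ultimately have "2 \<le> degree T x"
        using h(3) card_mono[of "parcs T `` {x}" "{y1, z}"] by (simp add: degree_eq_card_Image)
      then show False using 2 h(5) deg_simps(1) cardA by simp
    next
      case 3
      then have "y2 \<noteq> x" "y1 \<noteq> x" using old(2) h(3) T.no_loops' by auto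
      then show False
        using no_path[of y2 y1] 3 old T.arcs_symmetric h z2 deg_simps(1) deg_old nA by auto
    next
      case 4
      then have "degree T y1 = 2" "degree T y2 = 2" "degree T z = 2"
        using deg_old h z2 nA by auto
      then show False using T old h(3) unfolding partial_tree_def by blast
    qed
  qed
  have settled: "settled G ?T' v"
    if v: "v \<in> pverts ?T' - (X - {x} \<union> (if 3 \<le> degree T x + card A then {} else A))" for v
  proof (cases "v \<in> A")
    case True
    then have "3 \<le> degree ?T' x" using v deg_simps(1) by (auto split: if_splits)
    then show ?thesis
      unfolding settled_def using arcs_leaf' deg_simps(2) True by (metis zero_neq_one)
  next
    case False
    show ?thesis
    proof (cases "v = x")
      case True
      then show ?thesis using deg deg_simps(1) by (auto simp: settled_def)
    next
      case vx: False
      show ?thesis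
      proof (cases "parcs G `` {v} \<subseteq> pverts T")
        case True
        then show ?thesis by (auto simp: settled_def)
      next
        case out: False
        have "v \<in> pverts T" "v \<notin> X" using v False vx by (auto split: if_splits)
        then have "settled G T v" using T by (simp add: partial_tree_def)
        then have *: "degree T v \<noteq> 0"
          "\<And>p. degree T v = 1 \<Longrightarrow> (v, p) \<in> parcs T \<Longrightarrow> 3 \<le> degree T p"
          using out by (auto simp: settled_def)
        have "degree ?T' v = degree T v" using deg_simps(3) vx False by simp
        moreover have "3 \<le> degree ?T' p" if "degree T v = 1" "(v, p) \<in> parcs ?T'" for p
        proof -
          have "(v, p) \<in> parcs T" using arcs_old arcs_leaf that(2) vx False by metis
          then show ?thesis using *(2) that(1) deg_mono T.wellformed' le_trans by metis
        qed
        ultimately show ?thesis using *(1) by (simp add: settled_def)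
      qed
    qed
  qed
  have "undirected_tree ?T'" by (rule undirected_tree_attach) (fact tree x disj fin)+
  moreover have "parcs ?T' \<subseteq> parcs G"
    using sub A(1) G.arcs_symmetric by auto
  moreover have "pverts ?T' \<subseteq> pverts G"
    using sub A_G by simp
  moreover have "\<forall>y1 y2 z. (y1, y2) \<in> parcs ?T' \<longrightarrow> (y2, z) \<in> parcs ?T' \<longrightarrow> y1 \<noteq> z \<longrightarrow>
      degree ?T' y1 = 2 \<longrightarrow> degree ?T' y2 = 2 \<longrightarrow> degree ?T' z \<noteq> 2"
    using no_bad by (intro allI impI)
  moreover have "\<forall>v \<in> pverts ?T' - (X - {x} \<union> (if 3 \<le> degree T x + card A then {} else A)).
      settled G ?T' v"
    using settled by (intro ballI)
  ultimately show ?thesis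
    unfolding partial_tree_def by (intro conjI)
qed

text \<open>Ends a chain of attachments: an exempt vertex whose neighbours have all been absorbed
  satisfies the first alternative of \<open>settled\<close>.\<close>

lemma partial_tree_exempt_closed:
  assumes "partial_tree G T X" "\<And>v. v \<in> X \<Longrightarrow> parcs G `` {v} \<subseteq> pverts T"
  shows "partial_tree G T {}"
proof -
  have "settled G T v" if "v \<in> pverts T" for v
    using assms that by (cases "v \<in> X") (auto simp: settled_def partial_tree_def)
  then show ?thesis
    using assms(1) by (simp add: partial_tree_def)
qed

lemma pair_graph_partial_tree: "partial_tree G T X \<Longrightarrow> pair_graph T"
  by (simp add: partial_tree_def undirected_tree_def undirected_forest_def)

section \<open>Enlarging a partial tree that does not span\<close>

lemma connected_crossing_arc:
  assumes "pair_graph G" "connected (with_proj G)" "S \<subseteq> pverts G" "S \<noteq> {}" "S \<noteq> pverts G"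
  obtains v u where "v \<in> S" "u \<notin> S" "(v, u) \<in> parcs G"
proof -
  interpret G: pair_graph G by fact
  obtain a b where ab: "a \<in> S" "b \<in> pverts G" "b \<notin> S" using assms by blast
  have "a \<rightarrow>\<^sup>*\<^bsub>with_proj G\<^esub> b"
    using G.symmetric_connected_imp_strongly_connected[OF G.sym_arcs assms(2)] ab assms(3)
    by (auto simp: strongly_connected_def)
  then have "(a, b) \<in> (parcs G)\<^sup>*" using reachable_rtranclI[of "with_proj G" a b] by simp
  then have "\<exists>v u. v \<in> S \<and> u \<notin> S \<and> (v, u) \<in> parcs G"
    using ab(1,3) by (induction rule: rtrancl_induct) auto
  then show thesis using that by blast
qed

text \<open>By contradiction: once \<open>maximal\<close> is available, every chain of attachments
  that ends with an empty exempt set refutes its case.\<close>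

lemma partial_tree_extend:
  assumes G: "pair_graph G" and conn: "connected (with_proj G)"
    and mindeg: "\<forall>v \<in> pverts G. 3 \<le> degree G v"
    and T: "partial_tree G T {}" and ne: "pverts T \<noteq> pverts G"
  shows "\<exists>T'. partial_tree G T' {} \<and> pverts T \<subset> pverts T'"
proof (rule ccontr)
  assume "\<not> ?thesis"
  then have maximal: "\<not> pverts T \<subset> pverts T'" if "partial_tree G T' {}" for T'
    using that by blast
  interpret G: pair_graph G by fact
  have pT: "pair_graph T" using T by (rule pair_graph_partial_tree)
  interpret T: pair_graph T by fact
  \<comment> \<open>Outside neighbours are always counted relative to the original \<open>T\<close>,
    also for vertices outside \<open>T\<close> and after further attachments.\<close>
  define N where "N v = parcs G `` {v} - pverts T" for v
  have finN: "finite (N v)" for v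
    using G.pair_finite_arcs by (simp add: N_def finite_Image)
  have N_sym: "v \<in> N u" if "u \<in> N v" "v \<notin> pverts T" for u v
    using that G.arcs_symmetric by (auto simp: N_def)
  have N_irrefl: "u \<notin> N u" for u using G.no_loops' by (auto simp: N_def)
  have N_outside: "u \<notin> pverts T" if "u \<in> N v" for u v using that by (simp add: N_def)
  \<comment> \<open>Attaching all of \<open>N v\<close> must leave \<open>v\<close> with degree at
    most 2. Both the degree of \<open>v\<close> and the size of \<open>N v\<close> are positive, so
    both equal 1, and being settled then bounds the degrees of the neighbours of
    \<open>v\<close>.\<close>
  have leaf: "degree T v = 1 \<and> N v = {u} \<and> (\<forall>p. (v, p) \<in> parcs T \<longrightarrow> 3 \<le> degree T p)"
    if v: "v \<in> pverts T" and u: "u \<in> N v" for v u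
  proof -
    have live: "degree T v \<noteq> 0 \<and> (degree T v = 1 \<longrightarrow> (\<forall>p. (v, p) \<in> parcs T \<longrightarrow> 3 \<le> degree T p))"
      using T u v by (auto simp: partial_tree_def settled_def N_def)
    have "\<not> 3 \<le> degree T v + card (N v)"
    proof
      assume "3 \<le> degree T v + card (N v)"
      then have "partial_tree G (attach T v (N v)) {}"
        using partial_tree_attach[OF G T v, of "N v"] u by (auto simp: N_def)
      from maximal[OF this] show False using u by (auto simp: N_def)
    qed
    moreover have "card {u} \<le> card (N v)" using u finN by (intro card_mono) auto
    ultimately have "degree T v = 1" "card (N v) = 1" using live by auto
    then show ?thesis using u live by (auto simp: card_1_singleton_iff)
  qed
  \<comment> \<open>The endpoints are parameters because \<open>few\<close> is applied to a second
    arc later. In \<open>T1 v u\<close> the leaf \<open>u\<close> is exempt, since its neighbour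
    \<open>v\<close> has degree only 2.\<close>
  define T1 where "T1 v u = attach T v {u}" for v u
  have T1: "partial_tree G (T1 v u) {u}" "degree (T1 v u) v = 2" "degree (T1 v u) u = 1"
    and T1_other: "\<And>w. w \<noteq> v \<Longrightarrow> w \<noteq> u \<Longrightarrow> degree (T1 v u) w = degree T w"
    if v: "v \<in> pverts T" and u: "u \<in> N v" for v u
  proof -
    have new: "{u} \<inter> pverts T = {}" "finite {u}" using N_outside u by auto
    note degs = degree_attach[OF pT v new]
    show "degree (T1 v u) v = 2" "degree (T1 v u) u = 1"
      "\<And>w. w \<noteq> v \<Longrightarrow> w \<noteq> u \<Longrightarrow> degree (T1 v u) w = degree T w"
      using degs leaf[OF v u] by (simp_all add: T1_def)
    show "partial_tree G (T1 v u) {u}"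
      using partial_tree_attach[OF G T v, of "{u}"] leaf[OF v u] u
      by (force simp: N_def T1_def)
  qed
  \<comment> \<open>With two vertices in \<open>N u\<close>, attaching \<open>u\<close> to
    \<open>v\<close> and then \<open>N u\<close> to \<open>u\<close> would give \<open>u\<close>
    degree at least 3 and leave nothing exempt.\<close>
  have few: "card (N u) \<le> 1" if v: "v \<in> pverts T" and u: "u \<in> N v" for v u
  proof (rule ccontr)
    assume "\<not> card (N u) \<le> 1"
    then have "N u \<noteq> {}" "3 \<le> 1 + card (N u)" by auto
    then have "partial_tree G (attach (T1 v u) u (N u)) {}"
      using partial_tree_attach[OF G T1(1)[OF v u], of u "N u"] T1(3)[OF v u] N_irrefl[of u]
      by (auto simp: N_def T1_def)
    from maximal[OF this] show False using N_outside[OF u]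
      by (auto simp: T1_def)
  qed
  have "connected (with_proj T)" "pverts T \<subseteq> pverts G"
    using T by (auto simp: partial_tree_def undirected_tree_def)
  moreover from this have "pverts T \<noteq> {}" by (simp add: connected_conv)
  ultimately obtain v u where v: "v \<in> pverts T" and "u \<notin> pverts T" "(v, u) \<in> parcs G"
    using connected_crossing_arc[OF G conn] ne by metis
  then have u: "u \<in> N v" by (simp add: N_def)
  note v_leaf = leaf[OF v u] and T1_vu = T1[OF v u] T1_other[OF v u]
  have "N u \<noteq> {}"
  proof
    assume "N u = {}"
    then have "partial_tree G (T1 v u) {}"
      using partial_tree_exempt_closed[OF T1_vu(1)] by (auto simp: N_def T1_def)
    from maximal[OF this] show False using N_outside[OF u] by (auto simp: T1_def)
  qed
  then have "card (N u) \<noteq> 0" using finN by simp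
  then have "card (N u) = 1" using few[OF v u] by linarith
  then obtain u' where Nu: "N u = {u'}" by (rule card_1_singletonE)
  have u': "u' \<in> N u" "u' \<noteq> u" "u' \<notin> pverts T" "(u, u') \<in> parcs G"
    using Nu N_irrefl N_outside by (auto simp: N_def)
  have u_N': "u \<in> N u'" using N_sym u'(1) N_outside u by blast
  show False
  proof (cases "\<exists>v' \<in> pverts T. u' \<in> N v'")
    case True
    then obtain v' where v': "v' \<in> pverts T" "u' \<in> N v'" by blast
    have v'_leaf: "degree T v' = 1" "\<And>p. (v', p) \<in> parcs T \<Longrightarrow> 3 \<le> degree T p"
      using leaf[OF v'] by auto
    have "v' \<noteq> v" using leaf[OF v'] v_leaf u'(2) by auto
    have "v' \<noteq> u" using v'(1) N_outside u by auto
    have deg_v': "degree (T1 v u) v' = 1"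
      using T1_vu(4) \<open>v' \<noteq> v\<close> \<open>v' \<noteq> u\<close> v'_leaf(1) by simp
    \<comment> \<open>In \<open>T\<close> the neighbours of \<open>v'\<close> have degree at least
      3, so they differ from the leaf \<open>v\<close> and keep their degree in
      \<open>T1 v u\<close>.\<close>
    have nbr: "degree (T1 v u) p \<noteq> 2" if "(v', p) \<in> parcs (T1 v u)" for p
    proof -
      have "(v', p) \<in> parcs T" using that \<open>v' \<noteq> v\<close> \<open>v' \<noteq> u\<close> by (auto simp: T1_def)
      then have "3 \<le> degree T p" "p \<in> pverts T" using v'_leaf(2) T.in_arcsD2 by blast+
      moreover from this have "p \<noteq> v" using v_leaf by auto
      moreover have "p \<noteq> u" using \<open>p \<in> pverts T\<close> N_outside[OF u] by blast
      ultimately show ?thesis using T1_vu(4) by simp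
    qed
    \<comment> \<open>Here \<open>u'\<close> is hung on \<open>v'\<close> instead of
      \<open>u\<close>. The exempt leaves \<open>u\<close> and \<open>u'\<close> are each other's
      only outside neighbours, so both are closed in \<open>?T2\<close>.\<close>
    let ?T2 = "attach (T1 v u) v' {u'}"
    have "partial_tree G ?T2 ({u} - {v'} \<union> {u'})"
      using partial_tree_attach[OF G T1_vu(1), of v' "{u'}"] v' u' deg_v' nbr
      by (auto simp: N_def T1_def)
    moreover have "N u' = {u}"
      using few[OF v'] u_N' finN[of u'] by (auto simp: card_le_Suc0_iff_eq)
    then have "parcs G `` {w} \<subseteq> pverts ?T2" if "w \<in> {u} - {v'} \<union> {u'}" for w
      using that Nu by (auto simp: N_def T1_def)
    ultimately have "partial_tree G ?T2 {}" by (rule partial_tree_exempt_closed)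
    from maximal[OF this] show False using N_outside[OF u] by (auto simp: T1_def)
  next
    case False
    \<comment> \<open>Now no neighbour of \<open>u'\<close> lies in \<open>T\<close>, so besides
      \<open>u\<close> at least two remain to be attached to \<open>u'\<close>, which thereby gets
      degree at least 3.\<close>
    let ?T2 = "attach (T1 v u) u {u'}" and ?A = "parcs G `` {u'} - {u}"
    have nbr: "p = v" if "(u, p) \<in> parcs (T1 v u)" for p
      using that N_outside[OF u] T.wellformed' by (auto simp: T1_def)
    \<comment> \<open>Raising \<open>u\<close> to degree 2 puts it next to \<open>v\<close>, also of
      degree 2. The path cannot continue badly, because the remaining neighbour of \<open>v\<close>
      has degree at least 3.\<close>
    have nbr2: "degree (T1 v u) q \<noteq> 2" if "(v, q) \<in> parcs (T1 v u)" "q \<noteq> u" for q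
    proof -
      have q: "(v, q) \<in> parcs T" using that v N_outside[OF u] by (auto simp: T1_def)
      then have "q \<noteq> v" using T.no_loops' by blast
      then have "degree (T1 v u) q = degree T q" using T1_vu(4) that(2) by blast
      moreover have "3 \<le> degree T q" using q v_leaf by blast
      ultimately show ?thesis by linarith
    qed
    have "partial_tree G ?T2
        ({u} - {u} \<union> (if 3 \<le> degree (T1 v u) u + card {u'} then {} else {u'}))"
    proof (rule partial_tree_attach[OF G T1_vu(1)])
      show "degree (T1 v u) q \<noteq> 2"
        if "(u, p) \<in> parcs (T1 v u)" "(p, q) \<in> parcs (T1 v u)" "q \<noteq> u" for p q
        using nbr nbr2 that by blast
    qed (use T1_vu(3) u' in \<open>simp_all add: T1_def\<close>)
    then have T2: "partial_tree G ?T2 {u'}" using T1_vu(3) by simp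
    have "degree ?T2 u' = 1"
      using degree_attach_leaf[OF pair_graph_partial_tree[OF T1_vu(1)], of u "{u'}" u'] u'
      by (simp add: T1_def)
    moreover have "?A \<subseteq> parcs G `` {u'} - pverts ?T2"
      using False G.arcs_symmetric G.no_loops'[of u' u'] u'(3) by (auto simp: N_def T1_def)
    moreover have "3 \<le> card (parcs G `` {u'})"
      using mindeg u'(4) G.wellformed' by (metis degree_eq_card_Image)
    then have "2 \<le> card ?A"
      using G.pair_finite_arcs by (auto simp: card_Diff_singleton_if finite_Image)
    moreover from this have "?A \<noteq> {}" by (metis card.empty not_numeral_le_zero)
    ultimately have "partial_tree G (attach ?T2 u' ?A) {}"
      using partial_tree_attach[OF G T2, of u' ?A] by simp
    from maximal[OF this] show False using N_outside[OF u] by (auto simp: T1_def)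
  qed
qed

section \<open>The starting star and a largest partial tree\<close>

lemma undirected_tree_singleton: "undirected_tree \<lparr>pverts = {r}, parcs = {}\<rparr>" (is "undirected_tree ?R")
proof -
  have "pair_graph ?R"
    by unfold_locales (auto simp: symmetric_def sym_def)
  then show ?thesis
    by (auto simp: undirected_tree_def undirected_forest_def connected_conv pre_digraph.cycle_def
        pre_digraph.awalk_def)
qed

theorem theorem1p2:
  fixes G :: "'a pair_pre_digraph"
  assumes "pair_graph G"
    and "connected (with_proj G)"
    and "\<forall>v \<in> pverts G. degree G v \<ge> 3"
  shows "\<exists>T. undirected_spanning_tree T G \<and>
           \<not> (\<exists>x y z. vpath [x, y, z] (with_proj T) \<and>
                degree T x = 2 \<and> degree T y = 2 \<and> degree T z = 2)"
proof -
  interpret G: pair_graph G by fact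
  obtain r where r: "r \<in> pverts G" using assms(2) by (auto simp: connected_conv)
  let ?R = "\<lparr>pverts = {r}, parcs = {}\<rparr>" and ?N = "parcs G `` {r}"
  \<comment> \<open>The single vertex \<open>r\<close> has degree 0 and outside neighbours, so it
    starts exempt; attaching all its neighbours, at least three, settles everything.\<close>
  have "partial_tree G ?R {r}"
    using r undirected_tree_singleton by (simp add: partial_tree_def)
  moreover have "?N \<subseteq> ?N - pverts ?R" using G.no_loops' by auto
  moreover have "3 \<le> card ?N" using assms(3) r by (simp add: degree_eq_card_Image)
  moreover from this have "?N \<noteq> {}" by auto
  ultimately have start: "partial_tree G (attach ?R r ?N) {}"
    using partial_tree_attach[OF assms(1), of ?R "{r}" r ?N] by simp
  \<comment> \<open>\<open>ex_has_greatest_nat\<close> asks for a strict upper bound, hence the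
    successor.\<close>
  have "\<forall>T. partial_tree G T {} \<longrightarrow> card (pverts T) < Suc (card (pverts G))"
    using G.pair_finite_verts by (simp add: partial_tree_def card_mono less_Suc_eq_le)
  from ex_has_greatest_nat[of "\<lambda>T. partial_tree G T {}", OF start this]
  obtain T where T: "partial_tree G T {}"
    and maximal: "\<And>T'. partial_tree G T' {} \<Longrightarrow> card (pverts T') \<le> card (pverts T)"
    by blast
  interpret T: pair_graph T using T by (rule pair_graph_partial_tree)
  have "pverts T = pverts G"
  proof (rule ccontr)
    assume "pverts T \<noteq> pverts G"
    then obtain T' where T': "partial_tree G T' {}" "pverts T \<subset> pverts T'"
      using partial_tree_extend[OF assms T] by blast
    then have "finite (pverts T')"
      using G.pair_finite_verts finite_subset unfolding partial_tree_def by blast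
    then have "card (pverts T) < card (pverts T')" using T'(2) by (rule psubset_card_mono)
    then show False using maximal[OF T'(1)] by simp
  qed
  then have "undirected_spanning_tree T G"
    using T G.wf_digraph T.wf_digraph
    by (auto simp: undirected_spanning_tree_def spanning_def subgraph_def partial_tree_def)
  moreover have "\<not> (\<exists>x y z. vpath [x, y, z] (with_proj T) \<and>
      degree T x = 2 \<and> degree T y = 2 \<and> degree T z = 2)"
  proof
    assume "\<exists>x y z. vpath [x, y, z] (with_proj T) \<and>
      degree T x = 2 \<and> degree T y = 2 \<and> degree T z = 2"
    then obtain x y z where "(x, y) \<in> parcs T" "(y, z) \<in> parcs T" "x \<noteq> z"
      "degree T x = 2" "degree T y = 2" "degree T z = 2"
      by (auto simp: vpath_def vwalk_def)
    then show False using T unfolding partial_tree_def by blast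
  qed
  ultimately show ?thesis by blast
qed

end
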